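(* Let $\nu>0$, $\beta\ge 0$, $\gamma\ge 0$, and suppose $f\in L^{2}(0,T;H^{-1}(\Omega)^{d})$. Let $u_h^0,u_h^1\in X_h$ be given and let $(\hat u_h^{n+1},p_h^{n+1},u_h^{n+1})\in X_h\times Q_h\times X_h$, $n=1,\dots,N-1$, be generated by the algorithm BDF2-mgd (defined in the context). Then for all $N\ge 1$, $$ \begin{aligned} &\|u^{N}_{h}\|^{2}+\|2u^{N}_{h}-u^{N-1}_{h}\|^{2}+\Big(\tfrac{2\gamma\Delta t}{3}+\beta\Big)\|\nabla\cdot u^{N}_{h}\|^{2}+\Big(\tfrac{2\gamma\Delta t}{3}+\beta\Big)\|\nabla\cdot(2u^{N}_{h}-u^{N-1}_{h})\|^{2}\\ &\quad+4\gamma\Delta t\sum_{n=1}^{N-1}\|\nabla\cdot u^{n+1}_{h}\|^{2}+2\nu\Delta t\sum_{n=1}^{N-1}\|\nabla\hat u^{n+1}_{h}\|^{2}\\ &\le \frac{2\Delta t}{\nu}\sum_{n=1}^{N-1}\|f^{n+1}\|_{-1}^{2}+\|u^{1}_{h}\|^{2}+\|2u^{1}_{h}-u^{0}_{h}\|^{2}\\ &\quad+\Big(\tfrac{2\gamma\Delta t}{3}+\beta\Big)\|\nabla\cdot u^{1}_{h}\|^{2}+\Big(\tfrac{2\gamma\Delta t}{3}+\beta\Big)\|\nabla\cdot(2u^{1}_{h}-u^{0}_{h})\|^{2}. \end{aligned} $$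
   Context: $\Omega\subset\mathbb R^d$ ($d=2,3$) is a bounded polyhedron; $(\cdot,\cdot)$ and $\|\cdot\|$ are the $L^2(\Omega)$ inner product and norm (for scalar-, vector- or matrix-valued functions). $X=H^1_0(\Omega)^d$, $Q=L^2_0(\Omega)=\{q\in L^2(\Omega):\int_\Omega q\,dx=0\}$. $H^{-1}(\Omega)$ is the dual of $H^1_0(\Omega)$, with norm $\|g\|_{-1}=\sup_{0\ne v\in X}(g,v)/\|\nabla v\|$, where $(g,v)$ also denotes the duality pairing. $X_h\subset X$ and $Q_h\subset Q$ are finite element (finite-dimensional) subspaces satisfying the discrete inf-sup condition $\inf_{q\in Q_h}\sup_{v\in X_h}\frac{(q,\nabla\cdot v)}{\|\nabla v\|\|q\|}\ge C_0>0$. The time interval $[0,T]$ is divided into $N$ intervals, $\Delta t=T/N$, $t^n=n\Delta t$, and $f^{n}=f(\cdot,t^{n})\in H^{-1}(\Omega)^d$. The skew-symmetric trilinear form is $$b(u,v,w)=\tfrac12(u\cdot\nabla v,w)-\tfrac12(u\cdot\nabla w,v),\qquad u,v,w\in X.$$ Algorithm BDF2-mgd, for $n\ge 1$: Step 1. Given $u_h^{n-1},u_h^n\in X_h$, find $(\hat u_h^{n+1},p_h^{n+1})\in X_h\times Q_h$ such that for all $v_h\in X_h$ and $q_h\in Q_h$, $$\Big(\tfrac{3\hat u_h^{n+1}-4u_h^n+u_h^{n-1}}{2\Delta t},v_h\Big)+b(2u_h^n-u_h^{n-1},\hat u_h^{n+1},v_h)+\nu(\nabla\hat u_h^{n+1},\nabla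 v_h)-(p_h^{n+1},\nabla\cdot v_h)=(f^{n+1},v_h),$$ $$(\nabla\cdot\hat u_h^{n+1},q_h)=0.$$ Step 2. Given $\hat u_h^{n+1}$, find $u_h^{n+1}\in X_h$ such that for all $v_h\in X_h$, $$\Big(\tfrac{3u_h^{n+1}-3\hat u_h^{n+1}}{2\Delta t},v_h\Big)+\beta\Big(\nabla\cdot\tfrac{3u_h^{n+1}-4u_h^n+u_h^{n-1}}{2\Delta t},\nabla\cdot v_h\Big)+\gamma(\nabla\cdot u_h^{n+1},\nabla\cdot v_h)=0.$$ *)

theory Defs
  imports "HOL-Analysis.Analysis"
begin

type_synonym 'd scalar_field = "real ^ 'd \<Rightarrow> real"
type_synonym 'd vector_field = "real ^ 'd \<Rightarrow> real ^ 'd"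
type_synonym 'd functional = "'d vector_field \<Rightarrow> real"

text \<open>
  The library predicate \<^const>\<open>polyhedron\<close> describes convex sets only. A bounded polyhedron in the
  sense of finite element theory is the open, possibly non-convex, set enclosed by finitely
  many polytopes.
\<close>

definition bounded_polyhedral_domain :: "(real ^ 'd) set \<Rightarrow> bool" where
  "bounded_polyhedral_domain \<Omega> \<longleftrightarrow>
     \<Omega> \<noteq> {} \<and> (\<exists>\<P>. finite \<P> \<and> (\<forall>P\<in>\<P>. polytope P) \<and> \<Omega> = interior (\<Union>\<P>))"

text \<open>
  Members of the function spaces below are functions on the whole of $R^d$; only their values
  on \<open>\<Omega>\<close> matter, and equality almost everywhere is not quotiented out.
  An element is nonzero in the quotient iff its \<open>L2_norm\<close> is nonzero.
  For matrix-valued functions the inner product is the Frobenius one.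
\<close>

definition L2 :: "(real ^ 'd) set \<Rightarrow> (real ^ 'd \<Rightarrow> 'b::euclidean_space) set" where
  "L2 \<Omega> = {f \<in> borel_measurable (lebesgue_on \<Omega>). integrable (lebesgue_on \<Omega>) (\<lambda>x. (norm (f x))\<^sup>2)}"

definition L2_inner ::
    "(real ^ 'd) set \<Rightarrow> (real ^ 'd \<Rightarrow> 'b::euclidean_space) \<Rightarrow> (real ^ 'd \<Rightarrow> 'b) \<Rightarrow> real" where
  "L2_inner \<Omega> f g = (LINT x|lebesgue_on \<Omega>. f x \<bullet> g x)"

definition L2_norm :: "(real ^ 'd) set \<Rightarrow> (real ^ 'd \<Rightarrow> 'b::euclidean_space) \<Rightarrow> real" where
  "L2_norm \<Omega> f = sqrt (L2_inner \<Omega> f f)"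

definition L2_mean_zero :: "(real ^ 'd) set \<Rightarrow> 'd scalar_field set" where
  "L2_mean_zero \<Omega> = {q \<in> L2 \<Omega>. (LINT x|lebesgue_on \<Omega>. q x) = 0}"

definition partial_deriv :: "'d::finite \<Rightarrow> 'd scalar_field \<Rightarrow> 'd scalar_field" where
  "partial_deriv i \<phi> = (\<lambda>x. frechet_derivative \<phi> (at x) (axis i 1))"

definition smooth :: "'d::finite scalar_field \<Rightarrow> bool" where
  "smooth \<phi> \<longleftrightarrow> (\<forall>is x. foldr partial_deriv is \<phi> differentiable (at x))"

definition test_functions :: "(real ^ 'd) set \<Rightarrow> 'd scalar_field set" where
  "test_functions \<Omega> =
     {\<phi>. smooth \<phi> \<and> compact (closure {x. \<phi> x \<noteq> 0}) \<and> closure {x. \<phi> x \<noteq> 0} \<subseteq> \<Omega>}"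

definition has_weak_partial ::
    "(real ^ 'd) set \<Rightarrow> 'd \<Rightarrow> 'd scalar_field \<Rightarrow> 'd scalar_field \<Rightarrow> bool" where
  "has_weak_partial \<Omega> i v g \<longleftrightarrow>
     (\<forall>\<phi>\<in>test_functions \<Omega>. L2_inner \<Omega> v (partial_deriv i \<phi>) = - L2_inner \<Omega> g \<phi>)"

definition H1 :: "(real ^ 'd) set \<Rightarrow> 'd scalar_field set" where
  "H1 \<Omega> = {v \<in> L2 \<Omega>. \<forall>i. \<exists>g\<in>L2 \<Omega>. has_weak_partial \<Omega> i v g}"

text \<open>A representative, unique up to null sets, of the weak derivative of \<open>v \<in> H1 \<Omega>\<close>:\<close>

definition weak_partial :: "(real ^ 'd) set \<Rightarrow> 'd \<Rightarrow> 'd scalar_field \<Rightarrow> 'd scalar_field" where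
  "weak_partial \<Omega> i v = (SOME g. g \<in> L2 \<Omega> \<and> has_weak_partial \<Omega> i v g)"

definition H1_norm :: "(real ^ 'd) set \<Rightarrow> 'd scalar_field \<Rightarrow> real" where
  "H1_norm \<Omega> v = sqrt ((L2_norm \<Omega> v)\<^sup>2 + (\<Sum>i\<in>UNIV. (L2_norm \<Omega> (weak_partial \<Omega> i v))\<^sup>2))"

definition H10 :: "(real ^ 'd) set \<Rightarrow> 'd scalar_field set" where
  "H10 \<Omega> = {v \<in> H1 \<Omega>. \<forall>\<epsilon>>0. \<exists>\<phi>\<in>test_functions \<Omega>. H1_norm \<Omega> (\<lambda>x. v x - \<phi> x) < \<epsilon>}"

definition H10_vec :: "(real ^ 'd) set \<Rightarrow> 'd vector_field set" where
  "H10_vec \<Omega> = {v. \<forall>i. (\<lambda>x. v x $ i) \<in> H10 \<Omega>}"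

definition grad :: "(real ^ 'd) set \<Rightarrow> 'd vector_field \<Rightarrow> real ^ 'd \<Rightarrow> real ^ 'd ^ 'd" where
  "grad \<Omega> v = (\<lambda>x. \<chi> i j. weak_partial \<Omega> j (\<lambda>y. v y $ i) x)"

definition dvg :: "(real ^ 'd) set \<Rightarrow> 'd vector_field \<Rightarrow> 'd scalar_field" where
  "dvg \<Omega> v = (\<lambda>x. \<Sum>i\<in>UNIV. weak_partial \<Omega> i (\<lambda>y. v y $ i) x)"

definition convect :: "(real ^ 'd) set \<Rightarrow> 'd vector_field \<Rightarrow> 'd vector_field \<Rightarrow> 'd vector_field" where
  "convect \<Omega> u v = (\<lambda>x. grad \<Omega> v x *v u x)"

definition trilinear ::
    "(real ^ 'd) set \<Rightarrow> 'd vector_field \<Rightarrow> 'd vector_field \<Rightarrow> 'd vector_field \<Rightarrow> real" where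
  "trilinear \<Omega> u v w =
     1/2 * L2_inner \<Omega> (convect \<Omega> u v) w - 1/2 * L2_inner \<Omega> (convect \<Omega> u w) v"

text \<open>
  $H^{-1}(\Omega)^d$ as the dual of $H^1_0(\Omega)^d$, the latter normed by \<open>v \<mapsto> L2_norm \<Omega> (grad \<Omega> v)\<close>.
  The values of a functional outside \<open>H10_vec \<Omega>\<close> are irrelevant.
\<close>

definition Hm1 :: "(real ^ 'd) set \<Rightarrow> 'd functional set" where
  "Hm1 \<Omega> = {g.
     (\<forall>v\<in>H10_vec \<Omega>. \<forall>w\<in>H10_vec \<Omega>. g (\<lambda>x. v x + w x) = g v + g w) \<and>
     (\<forall>v\<in>H10_vec \<Omega>. \<forall>c. g (\<lambda>x. c *\<^sub>R v x) = c * g v) \<and>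
     (\<exists>C. \<forall>v\<in>H10_vec \<Omega>. \<bar>g v\<bar> \<le> C * L2_norm \<Omega> (grad \<Omega> v))}"

definition Hm1_norm :: "(real ^ 'd) set \<Rightarrow> 'd functional \<Rightarrow> real" where
  "Hm1_norm \<Omega> g =
     (SUP v\<in>{v \<in> H10_vec \<Omega>. L2_norm \<Omega> v \<noteq> 0}. g v / L2_norm \<Omega> (grad \<Omega> v))"

text \<open>
  The Bochner space $L^2(0,T;H^{-1}(\Omega)^d)$: almost everywhere limits of simple functions with
  square-integrable norm. The library's Bochner integral needs a normed type as codomain,
  which the set \<open>Hm1 \<Omega>\<close> is not.
\<close>

definition L2_time_Hm1 :: "(real ^ 'd) set \<Rightarrow> real \<Rightarrow> (real \<Rightarrow> 'd functional) set" where
  "L2_time_Hm1 \<Omega> T = {f.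
     (AE t in lebesgue_on {0<..<T}. f t \<in> Hm1 \<Omega>) \<and>
     (\<exists>s. (\<forall>k. simple_function (lebesgue_on {0<..<T}) (s k) \<and> (\<forall>t. s k t \<in> Hm1 \<Omega>)) \<and>
          (AE t in lebesgue_on {0<..<T}.
             (\<lambda>k. Hm1_norm \<Omega> (\<lambda>v. s k t v - f t v)) \<longlonglongrightarrow> 0)) \<and>
     integrable (lebesgue_on {0<..<T}) (\<lambda>t. (Hm1_norm \<Omega> (f t))\<^sup>2)}"

text \<open>Linear span of finitely many functions; function types are not an instance of
  \<^class>\<open>real_vector\<close>, so the library's \<^const>\<open>span\<close> does not apply.\<close>

definition finite_dim_space :: "(real ^ 'd \<Rightarrow> 'b::real_vector) set \<Rightarrow> bool" where
  "finite_dim_space V \<longleftrightarrow>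
     (\<exists>B. finite B \<and> V = {(\<lambda>x. \<Sum>b\<in>B. c b *\<^sub>R b x) | c. True})"

text \<open>Taken in the extended reals, so that no supremum or infimum is a junk value.\<close>

definition inf_sup_const ::
    "(real ^ 'd) set \<Rightarrow> 'd vector_field set \<Rightarrow> 'd scalar_field set \<Rightarrow> ereal" where
  "inf_sup_const \<Omega> Xh Qh =
     (INF q\<in>{q \<in> Qh. L2_norm \<Omega> q \<noteq> 0}. SUP v\<in>{v \<in> Xh. L2_norm \<Omega> v \<noteq> 0}.
        ereal (L2_inner \<Omega> q (dvg \<Omega> v) / (L2_norm \<Omega> (grad \<Omega> v) * L2_norm \<Omega> q)))"

text \<open>In the two steps below \<open>u0\<close>, \<open>u1\<close>, \<open>u2\<close> stand for $u_h^{n-1}$, $u_h^n$, $u_h^{n+1}$,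
  while \<open>uh\<close>, \<open>p\<close>, \<open>F\<close> stand for $\hat u_h^{n+1}$, $p_h^{n+1}$, $f^{n+1}$.\<close>

definition mgd_step1 ::
    "(real ^ 'd) set \<Rightarrow> 'd vector_field set \<Rightarrow> 'd scalar_field set \<Rightarrow> real \<Rightarrow> real \<Rightarrow> 'd functional \<Rightarrow>
     'd vector_field \<Rightarrow> 'd vector_field \<Rightarrow> 'd vector_field \<Rightarrow> 'd scalar_field \<Rightarrow> bool" where
  "mgd_step1 \<Omega> Xh Qh \<nu> \<Delta>t F u0 u1 uh p \<longleftrightarrow>
     uh \<in> Xh \<and> p \<in> Qh \<and>
     (\<forall>v\<in>Xh.
        L2_inner \<Omega> (\<lambda>x. (1 / (2 * \<Delta>t)) *\<^sub>R (3 *\<^sub>R uh x - 4 *\<^sub>R u1 x + u0 x)) v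
        + trilinear \<Omega> (\<lambda>x. 2 *\<^sub>R u1 x - u0 x) uh v
        + \<nu> * L2_inner \<Omega> (grad \<Omega> uh) (grad \<Omega> v)
        - L2_inner \<Omega> p (dvg \<Omega> v) = F v) \<and>
     (\<forall>q\<in>Qh. L2_inner \<Omega> (dvg \<Omega> uh) q = 0)"

definition mgd_step2 ::
    "(real ^ 'd) set \<Rightarrow> 'd vector_field set \<Rightarrow> real \<Rightarrow> real \<Rightarrow> real \<Rightarrow>
     'd vector_field \<Rightarrow> 'd vector_field \<Rightarrow> 'd vector_field \<Rightarrow> 'd vector_field \<Rightarrow> bool" where
  "mgd_step2 \<Omega> Xh \<beta> \<gamma> \<Delta>t u0 u1 uh u2 \<longleftrightarrow>
     u2 \<in> Xh \<and>
     (\<forall>v\<in>Xh.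
        L2_inner \<Omega> (\<lambda>x. (1 / (2 * \<Delta>t)) *\<^sub>R (3 *\<^sub>R u2 x - 3 *\<^sub>R uh x)) v
        + \<beta> * L2_inner \<Omega>
            (dvg \<Omega> (\<lambda>x. (1 / (2 * \<Delta>t)) *\<^sub>R (3 *\<^sub>R u2 x - 4 *\<^sub>R u1 x + u0 x))) (dvg \<Omega> v)
        + \<gamma> * L2_inner \<Omega> (dvg \<Omega> u2) (dvg \<Omega> v) = 0)"

definition BDF2_mgd ::
    "(real ^ 'd) set \<Rightarrow> 'd vector_field set \<Rightarrow> 'd scalar_field set \<Rightarrow> real \<Rightarrow> real \<Rightarrow> real \<Rightarrow>
     real \<Rightarrow> nat \<Rightarrow> (nat \<Rightarrow> 'd functional) \<Rightarrow>
     (nat \<Rightarrow> 'd vector_field) \<Rightarrow> (nat \<Rightarrow> 'd vector_field) \<Rightarrow> (nat \<Rightarrow> 'd scalar_field) \<Rightarrow> bool" where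
  "BDF2_mgd \<Omega> Xh Qh \<nu> \<beta> \<gamma> \<Delta>t N F u uhat p \<longleftrightarrow>
     (\<forall>n\<in>{1..N-1}.
        mgd_step1 \<Omega> Xh Qh \<nu> \<Delta>t (F (n+1)) (u (n-1)) (u n) (uhat (n+1)) (p (n+1)) \<and>
        mgd_step2 \<Omega> Xh \<beta> \<gamma> \<Delta>t (u (n-1)) (u n) (uhat (n+1)) (u (n+1)))"

end

theory Submission
  imports Defs
begin

text \<open>
  Test Step 1 with $\hat u_h^{n+1}$ (the convective and pressure terms vanish) and Step 2 with
  $u_h^{n+1}$ and with $3u_h^{n+1}-4u_h^n+u_h^{n-1}$. In a suitable linear combination the mixed terms
  cancel, the BDF2 differences telescope and only squares are left over; the forcing is absorbed by Young's
  inequality. Since weak derivatives are arbitrary representatives, linearity of the divergence holds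
  almost everywhere only and rests on the uniqueness of weak derivatives, that is, on the
  fundamental lemma of the calculus of variations: products of $\exp(-c/s)$ cut-offs converge to
  indicators of boxes as $c \to 0$, and boxes generate the Borel sets.
\<close>

section \<open>Smooth cut-off functions of boxes\<close>

definition bump :: "real poly \<Rightarrow> real \<Rightarrow> real \<Rightarrow> real" where
  "bump p c s = (if s > 0 then poly p (inverse s) * exp (- c * inverse s) else 0)"

text \<open>With \<open>y = 1/s\<close> this is the flatness of \<open>bump p c\<close> at
  \<open>s = 0\<close>. Each monomial reduces to the decay of \<open>z ^ k / exp z\<close> along
  \<open>z = c * y\<close>, and a polynomial is a finite combination of monomials.\<close>

lemma tendsto_poly_exp_0:
  fixes c :: real
  assumes "c > 0"
  shows "((\<lambda>y. poly p y * exp (- c * y)) \<longlongrightarrow> 0) at_top"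
proof -
  have mon: "((\<lambda>y. y ^ k * exp (- c * y)) \<longlongrightarrow> 0) at_top" for k
  proof -
    have "filterlim (\<lambda>y. c * y) at_top at_top"
      using assms filterlim_tendsto_pos_mult_at_top[OF tendsto_const] filterlim_ident by blast
    from filterlim_compose[OF tendsto_power_div_exp_0 this]
    have "((\<lambda>y. inverse (c ^ k) * ((c * y) ^ k / exp (c * y))) \<longlongrightarrow> inverse (c ^ k) * 0) at_top"
      by (intro tendsto_intros)
    moreover have "inverse (c ^ k) * ((c * y) ^ k / exp (c * y)) = y ^ k * exp (- c * y)" for y
      using assms by (simp add: exp_minus field_simps)
    ultimately show ?thesis by simp
  qed
  have "((\<lambda>y. \<Sum>i\<le>degree p. coeff p i * (y ^ i * exp (- c * y))) \<longlongrightarrow> (\<Sum>i\<le>degree p. coeff p i * 0)) at_top"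
    by (intro tendsto_intros mon)
  then show ?thesis
    by (simp add: poly_altdef sum_distrib_right mult.assoc)
qed

text \<open>For \<open>s > 0\<close> the chain rule multiplies the exponential by
  \<open>(c p - p') / s^2\<close>, with \<open>p\<close> and \<open>p'\<close> taken at
  \<open>1/s\<close>; the factor \<open>[:0, 0, 1:]\<close> is that \<open>1/s^2\<close>.
  Differentiation changes only the polynomial, which is why \<open>bump\<close> carries one as a
  parameter.\<close>

lemma bump_has_derivative:
  assumes "c > 0"
  shows "(bump p c has_real_derivative bump ([:0, 0, 1:] * (smult c p - pderiv p)) c s) (at s)"
proof (rule linorder_cases[of s 0])
  assume s: "s < 0"
  have ev: "\<forall>\<^sub>F x in nhds s. bump p c x = 0"
    using eventually_nhds_in_open[of "{..<0}" s] s by (auto elim!: eventually_mono simp: bump_def)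
  show ?thesis
    using DERIV_cong_ev[OF refl ev refl] s by (simp add: bump_def[of _ _ s])
next
  assume s: "s > 0"
  have ev: "\<forall>\<^sub>F x in nhds s. bump p c x = poly p (inverse x) * exp (- c * inverse x)"
    using eventually_nhds_in_open[of "{0<..}" s] s by (auto elim!: eventually_mono simp: bump_def)
  have "((\<lambda>x. poly p (inverse x) * exp (- c * inverse x)) has_real_derivative
     bump ([:0, 0, 1:] * (smult c p - pderiv p)) c s) (at s)"
    using s
    by (auto intro!: derivative_eq_intros DERIV_chain2[OF poly_DERIV] simp: bump_def field_simps power2_eq_square)
  then show ?thesis using DERIV_cong_ev[OF refl ev refl] by blast
next
  assume [simp]: "s = 0"
  \<comment> \<open>The difference quotient at 0 is again a polynomial times an exponential in
    \<open>y = 1/x\<close>, now with the polynomial \<open>[:0, 1:] * p\<close>.\<close>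
  have "((\<lambda>x. bump p c x / x) \<longlongrightarrow> 0) (at_right 0)"
  proof -
    have "((\<lambda>y. poly ([:0,1:] * p) y * exp (- c * y)) \<longlongrightarrow> 0) at_top"
      by (rule tendsto_poly_exp_0[OF assms])
    from filterlim_compose[OF this filterlim_inverse_at_top_right]
    have "((\<lambda>x. poly ([:0,1:] * p) (inverse x) * exp (- c * inverse x)) \<longlongrightarrow> 0) (at_right 0)" .
    then show ?thesis
      by (rule Lim_transform_eventually)
         (auto simp: eventually_at_right_less bump_def field_simps intro!: eventually_mono[OF eventually_at_right_less[of 0]])
  qed
  moreover have "((\<lambda>x. bump p c x / x) \<longlongrightarrow> 0) (at_left 0)"
    by (rule Lim_transform_eventually[OF tendsto_const])
       (auto simp: eventually_at_filter bump_def)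
  ultimately have "((\<lambda>x. bump p c x / x) \<longlongrightarrow> 0) (at 0)"
    by (simp add: filterlim_split_at)
  then show ?thesis
    by (simp add: has_field_derivative_iff bump_def)
qed

text \<open>Closed under \<^const>\<open>partial_deriv\<close>, so smoothness needs no formula for higher derivatives.\<close>

inductive_set bump_algebra :: "('d::finite) scalar_field set" where
  const: "(\<lambda>x. k) \<in> bump_algebra"
| coord: "c > 0 \<Longrightarrow> (\<lambda>x. bump p c (\<sigma> * x $ i - a)) \<in> bump_algebra"
| add: "f \<in> bump_algebra \<Longrightarrow> g \<in> bump_algebra \<Longrightarrow> (\<lambda>x. f x + g x) \<in> bump_algebra"
| mult: "f \<in> bump_algebra \<Longrightarrow> g \<in> bump_algebra \<Longrightarrow> (\<lambda>x. f x * g x) \<in> bump_algebra"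

lemma partial_deriv_eq:
  assumes "\<And>x. (f has_derivative f' x) (at x)"
  shows "partial_deriv j f = (\<lambda>x. f' x (axis j 1))"
  unfolding partial_deriv_def by (simp add: frechet_derivative_at[OF assms, symmetric])

text \<open>Induction over the generators. The two claims go together because the sum and product
  rules for \<open>partial_deriv\<close> presuppose that both parts are differentiable
  everywhere.\<close>

lemma bump_algebra_deriv:
  assumes "f \<in> bump_algebra"
  shows "f differentiable (at x) \<and> partial_deriv j f \<in> bump_algebra"
  using assms
proof (induction arbitrary: x)
  case (const k)
  show ?case
    using partial_deriv_eq[OF has_derivative_const, of j k] by (simp add: bump_algebra.const)
next
  case (coord c p \<sigma> i a)
  let ?q = "[:0, 0, 1:] * (smult c p - pderiv p)"
  let ?f = "\<lambda>x. bump p c (\<sigma> * x $ i - a)"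
  let ?f' = "\<lambda>x h. bump ?q c (\<sigma> * x $ i - a) * (\<sigma> * h $ i)"
  have D: "(?f has_derivative ?f' x) (at x)" for x
  proof -
    have 1: "((\<lambda>x. \<sigma> * x $ i - a) has_derivative (\<lambda>h. \<sigma> * h $ i)) (at x)"
      by (auto intro!: derivative_eq_intros bounded_linear.has_derivative[OF bounded_linear_vec_nth])
    show ?thesis
      using has_derivative_compose[OF 1 bump_has_derivative[OF coord, unfolded has_field_derivative_def], of p] .
  qed
  \<comment> \<open>Scaling the polynomial by \<open>\<sigma>\<close> or by 0 keeps the derivative
    in the shape of the rule \<open>coord\<close> whether or not \<open>i = j\<close>.\<close>
  have eq: "partial_deriv j ?f = (\<lambda>x. bump (smult (if i = j then \<sigma> else 0) ?q) c (\<sigma> * x $ i - a))"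
    using partial_deriv_eq[of ?f ?f', OF D]
    by (auto simp: axis_def bump_def fun_eq_iff simp del: mult_pCons_left)
  show ?case
    using D bump_algebra.coord[OF coord] unfolding eq differentiable_def by blast
next
  case (add f g)
  have "(f has_derivative frechet_derivative f (at x)) (at x)"
       "(g has_derivative frechet_derivative g (at x)) (at x)" for x
    using add.IH frechet_derivative_works by blast+
  note D = has_derivative_add[OF this]
  have eq: "partial_deriv j (\<lambda>x. f x + g x) = (\<lambda>x. partial_deriv j f x + partial_deriv j g x)"
    using partial_deriv_eq[OF D] by (simp add: partial_deriv_def)
  show ?case
    unfolding eq using D add.IH by (auto simp: differentiable_def intro!: bump_algebra.add)
next
  case (mult f g)
  have "(f has_derivative frechet_derivative f (at x)) (at x)"
       "(g has_derivative frechet_derivative g (at x)) (at x)" for x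
    using mult.IH frechet_derivative_works by blast+
  note D = has_derivative_mult[OF this]
  have eq: "partial_deriv j (\<lambda>x. f x * g x) = (\<lambda>x. f x * partial_deriv j g x + partial_deriv j f x * g x)"
    using partial_deriv_eq[OF D] by (simp add: partial_deriv_def)
  show ?case
    unfolding eq using D mult.IH mult.hyps
    by (auto simp: differentiable_def intro!: bump_algebra.add bump_algebra.mult)
qed

lemma bump_algebra_smooth:
  assumes "f \<in> bump_algebra"
  shows "smooth f"
proof -
  have "foldr partial_deriv is f \<in> bump_algebra" for "is"
    by (induction "is") (use assms bump_algebra_deriv in auto)
  then show ?thesis
    unfolding smooth_def using bump_algebra_deriv by blast
qed

lemma bump_algebra_prod:
  assumes "finite I" "\<And>i. i \<in> I \<Longrightarrow> f i \<in> bump_algebra"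
  shows "(\<lambda>x. \<Prod>i\<in>I. f i x) \<in> bump_algebra"
  using assms by (induction I) (auto intro: bump_algebra.const bump_algebra.mult)

text \<open>The factors are written in the shape required by the rule \<open>bump_algebra.coord\<close>.\<close>

definition box_bump :: "real ^ 'd \<Rightarrow> real ^ 'd \<Rightarrow> real \<Rightarrow> 'd::finite scalar_field" where
  "box_bump a b c x = (\<Prod>i\<in>UNIV. bump 1 c (1 * x $ i - a $ i) * bump 1 c (- 1 * x $ i - (- b $ i)))"

lemma box_bump_nz_iff: "box_bump a b c x \<noteq> 0 \<longleftrightarrow> x \<in> box a b"
  by (auto simp: box_bump_def bump_def mem_box_cart)

lemma box_bump_test_function:
  assumes "c > 0" "cbox a b \<subseteq> \<Omega>"
  shows "box_bump a b c \<in> test_functions \<Omega>"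
proof -
  have "box_bump a b c \<in> bump_algebra"
    unfolding box_bump_def[abs_def] using assms(1)
    by (intro bump_algebra_prod bump_algebra.mult bump_algebra.coord) auto
  moreover have "closure {x. box_bump a b c x \<noteq> 0} \<subseteq> cbox a b"
    by (simp add: box_bump_nz_iff closure_minimal box_subset_cbox closed_cbox)
  moreover have "compact (closure {x. box_bump a b c x \<noteq> 0})"
    by (simp add: box_bump_nz_iff bounded_box)
  ultimately show ?thesis
    using assms(2) bump_algebra_smooth by (auto simp: test_functions_def)
qed

lemma box_bump_bounds:
  assumes "c > 0"
  shows "0 \<le> box_bump a b c x" "box_bump a b c x \<le> 1"
proof -
  have "0 \<le> bump 1 c s \<and> bump 1 c s \<le> 1" for s
    using assms by (auto simp: bump_def)
  then show "0 \<le> box_bump a b c x" "box_bump a b c x \<le> 1"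
    unfolding box_bump_def by (auto intro!: prod_nonneg prod_le_1 mult_le_one)
qed

lemma box_bump_tendsto:
  "(\<lambda>k. box_bump a b (1 / real (Suc k)) x) \<longlonglongrightarrow> indicator (box a b) x"
proof -
  have *: "(\<lambda>k. bump 1 (1 / real (Suc k)) s) \<longlonglongrightarrow> (if s > 0 then 1 else 0)" for s
  proof (cases "s > 0")
    case True
    have "(\<lambda>k. exp (- (1 / real (Suc k)) * inverse s)) \<longlonglongrightarrow> exp (- 0 * inverse s)"
      by (intro tendsto_intros LIMSEQ_Suc[OF lim_1_over_n])
    then show ?thesis using True by (simp add: bump_def)
  qed (simp add: bump_def)
  have "(\<lambda>k. box_bump a b (1 / real (Suc k)) x) \<longlonglongrightarrow>
      (\<Prod>i\<in>UNIV. (if 1 * x $ i - a $ i > 0 then 1 else 0) * (if - 1 * x $ i - (- b $ i) > 0 then 1 else 0))"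
    unfolding box_bump_def by (intro tendsto_prod tendsto_mult *)
  also have "(\<Prod>i\<in>UNIV. (if 1 * x $ i - a $ i > 0 then 1 else 0) * (if - 1 * x $ i - (- b $ i) > 0 then 1 else 0))
      = (indicator (box a b) x :: real)"
    by (auto simp: indicator_def mem_box_cart intro!: prod.neutral)
  finally show ?thesis .
qed

section \<open>The fundamental lemma of the calculus of variations\<close>

lemma AE_0_if_box_integrals_0:
  fixes h :: "'a::euclidean_space \<Rightarrow> real"
  assumes int: "integrable lebesgue h" and total: "integral\<^sup>L lebesgue h = 0"
    and boxes: "\<And>a b. (LINT x:box a b|lebesgue. h x) = 0"
  shows "AE x in lebesgue. h x = 0"
proof -
  have si: "set_integrable lebesgue A h" if "A \<in> sets lebesgue" for A
    unfolding set_integrable_def using integrable_mult_indicator[OF that int] .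
  \<comment> \<open>Dynkin's argument: boxes are stable under intersection, and the sets over which
    \<open>h\<close> integrates to 0 are closed under complements and countable disjoint unions. The
    complement case rests on \<open>total\<close>.\<close>
  have borel0: "(LINT x:A|lebesgue. h x) = 0" if "A \<in> sets borel" for A
  proof -
    let ?G = "range (\<lambda>(a, b). box a b :: 'a set)"
    have A: "A \<in> sigma_sets UNIV ?G"
      using that by (subst (asm) borel_eq_box) simp
    have "sets (sigma UNIV ?G) = sets (borel :: 'a measure)"
      using borel_eq_box by metis
    then have sig: "B \<in> sets lebesgue" if "B \<in> sigma_sets UNIV ?G" for B
      using that by simp
    have stable: "Int_stable ?G"
      unfolding Int_stable_def by (auto simp: box_Int_box)
    show ?thesis
      using stable subset_UNIV[of ?G, folded Pow_UNIV] A
    proof (induction rule: sigma_sets_induct_disjoint)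
      case (basic A)
      then show ?case using boxes by auto
    next
      case (compl A)
      have "(LINT x:UNIV|lebesgue. h x) = (LINT x:A|lebesgue. h x) + (LINT x:UNIV - A|lebesgue. h x)"
        using sig[OF compl(1)] set_integral_Un[of A "UNIV - A" lebesgue h]
        by (simp add: si sets.Diff[of UNIV lebesgue, simplified])
      then show ?case
        using compl total by (simp add: set_lebesgue_integral_def)
    next
      case (union A)
      then have "A i \<in> sets lebesgue" for i
        using sig by blast
      then show ?case
        using union lebesgue_integral_countable_add[of A lebesgue h]
        by (simp add: si sets.countable_UN[of A UNIV] disjoint_family_on_def)
    qed (auto simp: set_lebesgue_integral_def)
  qed
  \<comment> \<open>A Lebesgue set differs from a Borel set only within a null set, so the Borel
    case suffices.\<close>
  have "(LINT x:A|lebesgue. h x) = 0" if A_sets: "A \<in> sets lebesgue" for A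
  proof -
    obtain S N N' where A: "A = S \<union> N" and N: "N \<subseteq> N'" "N' \<in> null_sets lborel" and S: "S \<in> sets lborel"
      using A_sets by (elim sets_completionE)
    have "AE x in lebesgue. x \<notin> N'"
      using N by (intro AE_completion AE_not_in)
    then have "AE x in lebesgue. x \<in> A \<longleftrightarrow> x \<in> S"
      by eventually_elim (use A N in auto)
    then have "(LINT x:A|lebesgue. h x) = (LINT x:S|lebesgue. h x)"
      unfolding set_lebesgue_integral_def
    proof (intro integral_cong_AE)
      show "(\<lambda>x. indicator A x *\<^sub>R h x) \<in> borel_measurable lebesgue"
        "(\<lambda>x. indicator S x *\<^sub>R h x) \<in> borel_measurable lebesgue"
        using A_sets S by (intro borel_measurable_integrable si[unfolded set_integrable_def]; simp)+
    qed (auto elim!: eventually_mono split: split_indicator)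
    then show ?thesis
      using borel0 S by simp
  qed
  then show ?thesis
    using density_unique_real[OF int, of "\<lambda>_. 0"] by simp
qed

lemma test_function_continuous:
  assumes "\<phi> \<in> test_functions \<Omega>"
  shows "continuous_on UNIV \<phi>" "continuous_on UNIV (partial_deriv i \<phi>)"
proof -
  have "foldr partial_deriv is \<phi> differentiable (at x)" for "is" x
    using assms by (auto simp: test_functions_def smooth_def)
  from this[of "[]"] this[of "[i]"]
  show "continuous_on UNIV \<phi>" "continuous_on UNIV (partial_deriv i \<phi>)"
    by (auto intro!: continuous_at_imp_continuous_on differentiable_imp_continuous_within)
qed

text \<open>The claim is local: on a box whose closed hull lies in \<open>\<Omega>\<close> the
  cut-offs are admissible test functions, and countably many such boxes cover
  \<open>\<Omega>\<close>. Extending \<open>g\<close> by zero to \<open>h\<close> moves the argument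
  to \<open>lebesgue\<close> on the whole space.\<close>

lemma fundamental_lemma:
  fixes g :: "real ^ 'd \<Rightarrow> real"
  assumes "open \<Omega>" and int: "integrable (lebesgue_on \<Omega>) g"
    and test: "\<And>\<phi>. \<phi> \<in> test_functions \<Omega> \<Longrightarrow> L2_inner \<Omega> g \<phi> = 0"
  shows "AE x in lebesgue_on \<Omega>. g x = 0"
proof -
  have \<Omega>: "\<Omega> \<inter> space lebesgue \<in> sets lebesgue"
    using \<open>open \<Omega>\<close> by auto
  define h where "h = (\<lambda>x. indicator \<Omega> x *\<^sub>R g x)"
  have h: "integrable lebesgue h"
    using int unfolding h_def by (simp add: integrable_restrict_space[OF \<Omega>])
  have box0: "(LINT x:box a b|lebesgue. h x) = 0" if "cbox a b \<subseteq> \<Omega>" for a b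
  proof -
    let ?\<phi> = "\<lambda>k. box_bump a b (1 / real (Suc k))"
    have \<phi>: "?\<phi> k \<in> test_functions \<Omega>" for k
      using box_bump_test_function[OF _ that] by simp
    have \<phi>_meas: "?\<phi> k \<in> borel_measurable lebesgue" for k
      using borel_measurable_continuous_onI[OF test_function_continuous(1)[OF \<phi>]]
      by (simp add: measurable_completion)
    have "(LINT x|lebesgue. ?\<phi> k x * h x) = 0" for k
      using test[OF \<phi>[of k]]
      unfolding L2_inner_def h_def by (simp add: integral_restrict_space[OF \<Omega>] mult_ac)
    moreover have "(\<lambda>k. LINT x|lebesgue. ?\<phi> k x * h x) \<longlonglongrightarrow> (LINT x|lebesgue. indicator (box a b) x * h x)"
    proof (rule integral_dominated_convergence[where w = "\<lambda>x. norm (h x)"])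
      show "AE x in lebesgue. (\<lambda>k. ?\<phi> k x * h x) \<longlonglongrightarrow> indicator (box a b) x * h x"
        by (intro AE_I2 tendsto_mult box_bump_tendsto tendsto_const)
      show "AE x in lebesgue. norm (?\<phi> k x * h x) \<le> norm (h x)" for k
        using box_bump_bounds[of "1 / real (Suc k)" a b]
        by (intro AE_I2) (auto simp: abs_mult intro!: mult_left_le_one_le)
      show "(\<lambda>x. ?\<phi> k x * h x) \<in> borel_measurable lebesgue" for k
        by (intro borel_measurable_times borel_measurable_integrable[OF h] \<phi>_meas)
      show "(\<lambda>x. indicator (box a b) x * h x) \<in> borel_measurable lebesgue"
        by (intro borel_measurable_times borel_measurable_integrable[OF h] borel_measurable_indicator) auto
    qed (use h in auto)
    ultimately show ?thesis
      using LIMSEQ_unique[OF tendsto_const[of 0]] by (auto simp: set_lebesgue_integral_def)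
  qed
  have null_box: "AE x in lebesgue. x \<in> box a b \<longrightarrow> h x = 0" if ab: "cbox a b \<subseteq> \<Omega>" for a b
  proof -
    let ?h = "\<lambda>x. indicator (box a b) x *\<^sub>R h x"
    have "AE x in lebesgue. ?h x = 0"
    proof (rule AE_0_if_box_integrals_0)
      show "integrable lebesgue ?h"
        by (intro integrable_mult_indicator h) auto
      show "integral\<^sup>L lebesgue ?h = 0"
        using box0[OF ab] by (simp add: set_lebesgue_integral_def)
      fix c d
      \<comment> \<open>Truncation to \<open>box a b\<close> turns the integral over an arbitrary
        box into one over a box inside \<open>box a b\<close>, where \<open>box0\<close>
        applies.\<close>
      obtain e f where ef: "box c d \<inter> box a b = box e f"
        using box_Int_box by blast
      have "(LINT x:box c d|lebesgue. ?h x) = (LINT x:box e f|lebesgue. h x)"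
        unfolding set_lebesgue_integral_def ef[symmetric] indicator_inter_arith
        by (simp add: mult.assoc)
      also have "\<dots> = 0"
      \<comment> \<open>When \<open>box e f\<close> is empty, \<open>cbox e f\<close> may still be a
        degenerate nonempty box outside \<open>cbox a b\<close>, so only the nonempty case can pass
        to closures.\<close>
      proof (cases "box e f = {}")
        case False
        have "box e f \<subseteq> cbox a b"
          unfolding ef[symmetric] by (rule order_trans[OF Int_lower2 box_subset_cbox])
        then have "closure (box e f) \<subseteq> cbox a b"
          by (rule closure_minimal) (rule closed_cbox)
        then have "cbox e f \<subseteq> cbox a b"
          by (simp only: closure_box[OF False])
        then show ?thesis using box0 ab by blast
      qed (simp add: set_lebesgue_integral_def)
      finally show "(LINT x:box c d|lebesgue. ?h x) = 0" .
    qed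
    then show ?thesis
      by eventually_elim auto
  qed
  define \<F> where "\<F> = {box a b | a b. cbox a b \<subseteq> \<Omega>}"
  have cover: "\<Union>\<F> = \<Omega>"
  proof
    show "\<Union>\<F> \<subseteq> \<Omega>"
      using box_subset_cbox unfolding \<F>_def by blast
    show "\<Omega> \<subseteq> \<Union>\<F>"
    proof
      fix x assume "x \<in> \<Omega>"
      then obtain a b where "cbox a b \<subseteq> \<Omega>" "x \<in> box a b"
        using open_contains_cbox[OF \<open>open \<Omega>\<close>] by metis
      then show "x \<in> \<Union>\<F>"
        unfolding \<F>_def by blast
    qed
  qed
  have "open S" if "S \<in> \<F>" for S
    using that open_box by (auto simp: \<F>_def)
  \<comment> \<open>Statements that hold almost everywhere can be joined only over countably many
    boxes, so Lindelof's theorem thins out the cover.\<close>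
  then obtain \<F>' where "\<F>' \<subseteq> \<F>" "countable \<F>'" and cover': "\<Union>\<F>' = \<Union>\<F>"
    using Lindelof by metis
  have "AE x in lebesgue. \<forall>B\<in>\<F>'. x \<in> B \<longrightarrow> h x = 0"
    using null_box \<open>\<F>' \<subseteq> \<F>\<close> unfolding \<F>_def by (intro AE_ball_countable' \<open>countable \<F>'\<close>) auto
  then have "AE x in lebesgue. x \<in> \<Omega> \<longrightarrow> g x = 0"
  proof eventually_elim
    case (elim x)
    show ?case
    proof
      assume x: "x \<in> \<Omega>"
      then have "h x = 0"
        using elim cover cover' by blast
      then show "g x = 0"
        using x by (simp add: h_def)
    qed
  qed
  then show ?thesis
    by (simp add: AE_restrict_space_iff[OF \<Omega>])
qed

section \<open>Square-integrable functions and their weak derivatives\<close>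

lemma L2_inner_commute: "L2_inner \<Omega> f g = L2_inner \<Omega> g f"
  by (simp add: L2_inner_def inner_commute)

lemma L2_inner_self_nonneg: "L2_inner \<Omega> f f \<ge> 0"
  by (simp add: L2_inner_def)

lemma L2_norm_nonneg: "L2_norm \<Omega> f \<ge> 0"
  by (simp add: L2_norm_def L2_inner_self_nonneg)

lemma L2_norm_power2: "(L2_norm \<Omega> f)\<^sup>2 = L2_inner \<Omega> f f"
  by (simp add: L2_norm_def L2_inner_self_nonneg)

lemma L2_integrable_inner:
  fixes f g :: "real ^ 'd \<Rightarrow> 'b::euclidean_space"
  assumes "f \<in> L2 \<Omega>" "g \<in> L2 \<Omega>"
  shows "integrable (lebesgue_on \<Omega>) (\<lambda>x. f x \<bullet> g x)"
proof (rule Bochner_Integration.integrable_bound)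
  show "integrable (lebesgue_on \<Omega>) (\<lambda>x. (norm (f x))\<^sup>2 + (norm (g x))\<^sup>2)"
    using assms by (auto simp: L2_def)
  show "AE x in lebesgue_on \<Omega>. norm (f x \<bullet> g x) \<le> norm ((norm (f x))\<^sup>2 + (norm (g x))\<^sup>2)"
  proof (rule AE_I2)
    fix x
    have "\<bar>f x \<bullet> g x\<bar> \<le> norm (f x) * norm (g x)"
      by (rule Cauchy_Schwarz_ineq2)
    also have "\<dots> \<le> (norm (f x))\<^sup>2 + (norm (g x))\<^sup>2"
      using sum_squares_bound[of "norm (f x)" "norm (g x)"] mult_nonneg_nonneg[of "norm (f x)" "norm (g x)"]
      unfolding mult.assoc by (simp del: mult_nonneg_nonneg)
    finally show "norm (f x \<bullet> g x) \<le> norm ((norm (f x))\<^sup>2 + (norm (g x))\<^sup>2)" by simp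
  qed
qed (use assms in \<open>auto simp: L2_def intro: borel_measurable_inner\<close>)

lemma L2_lincomb:
  fixes f g :: "real ^ 'd \<Rightarrow> 'b::euclidean_space"
  assumes "f \<in> L2 \<Omega>" "g \<in> L2 \<Omega>"
  shows "(\<lambda>x. a *\<^sub>R f x + b *\<^sub>R g x) \<in> L2 \<Omega>"
proof -
  have "integrable (lebesgue_on \<Omega>) (\<lambda>x. a\<^sup>2 * (f x \<bullet> f x) + 2 * a * b * (f x \<bullet> g x) + b\<^sup>2 * (g x \<bullet> g x))"
    using L2_integrable_inner assms by (intro Bochner_Integration.integrable_add integrable_mult_right) auto
  moreover have "(norm (a *\<^sub>R f x + b *\<^sub>R g x))\<^sup>2 = a\<^sup>2 * (f x \<bullet> f x) + 2 * a * b * (f x \<bullet> g x) + b\<^sup>2 * (g x \<bullet> g x)" for x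
    unfolding power2_norm_eq_inner
    by (simp add: inner_add_left inner_add_right inner_commute[of "g x" "f x"] power2_eq_square algebra_simps)
  moreover have "(\<lambda>x. a *\<^sub>R f x + b *\<^sub>R g x) \<in> borel_measurable (lebesgue_on \<Omega>)"
    using assms by (intro borel_measurable_add borel_measurable_scaleR) (auto simp: L2_def)
  ultimately show ?thesis
    by (simp add: L2_def)
qed

lemma L2_sum:
  assumes "finite I" "\<And>i. i \<in> I \<Longrightarrow> f i \<in> L2 \<Omega>"
  shows "(\<lambda>x. \<Sum>i\<in>I. f i x) \<in> L2 \<Omega>"
  using assms
proof (induction I)
  case empty
  then show ?case by (simp add: L2_def)
next
  case (insert i I)
  then show ?case using L2_lincomb[of "f i" \<Omega> "\<lambda>x. \<Sum>i\<in>I. f i x" 1 1] by simp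
qed

lemma L2_vec:
  fixes v :: "real ^ 'd \<Rightarrow> real ^ 'e"
  assumes "\<And>i. (\<lambda>x. v x $ i) \<in> L2 \<Omega>"
  shows "v \<in> L2 \<Omega>"
proof -
  have "v \<in> borel_measurable (lebesgue_on \<Omega>)"
    using assms by (subst borel_measurable_euclidean_space) (auto simp: L2_def Basis_vec_def inner_axis)
  moreover have "integrable (lebesgue_on \<Omega>) (\<lambda>x. \<Sum>i\<in>UNIV. (norm (v x $ i))\<^sup>2)"
    using assms by (auto simp: L2_def)
  ultimately show ?thesis
    by (simp add: L2_def norm_vec_def L2_set_def sum_nonneg)
qed

lemma L2_inner_lincomb:
  assumes "f \<in> L2 \<Omega>" "g \<in> L2 \<Omega>" "h \<in> L2 \<Omega>"
  shows "L2_inner \<Omega> (\<lambda>x. a *\<^sub>R f x + b *\<^sub>R g x) h = a * L2_inner \<Omega> f h + b * L2_inner \<Omega> g h"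
  unfolding L2_inner_def using L2_integrable_inner[OF assms(1,3)] L2_integrable_inner[OF assms(2,3)]
  by (simp add: inner_add_left)

lemma L2_inner_cong_AE:
  assumes "f \<in> L2 \<Omega>" "f' \<in> L2 \<Omega>" "h \<in> L2 \<Omega>" "AE x in lebesgue_on \<Omega>. f x = f' x"
  shows "L2_inner \<Omega> f h = L2_inner \<Omega> f' h"
  unfolding L2_inner_def using assms
  by (intro integral_cong_AE) (auto simp: L2_def intro: borel_measurable_inner)

lemma L2_norm_eq_0_AE:
  assumes "f \<in> L2 \<Omega>" "L2_norm \<Omega> f = 0"
  shows "AE x in lebesgue_on \<Omega>. f x = 0"
  using integral_nonneg_eq_0_iff_AE[OF L2_integrable_inner[OF assms(1,1)]] assms(2)
  by (simp add: L2_norm_def L2_inner_def)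

text \<open>\<open>L2_inner\<close> splits over a sum only where the products are integrable, hence
  the assumption on test functions and their derivatives; \<open>test_function_L2\<close> supplies
  it on a bounded open set.\<close>

lemma has_weak_partial_lincomb:
  assumes "v \<in> L2 \<Omega>" "w \<in> L2 \<Omega>" "g \<in> L2 \<Omega>" "h \<in> L2 \<Omega>"
    and "has_weak_partial \<Omega> i v g" "has_weak_partial \<Omega> i w h"
    and "\<And>\<phi>. \<phi> \<in> test_functions \<Omega> \<Longrightarrow> \<phi> \<in> L2 \<Omega> \<and> partial_deriv i \<phi> \<in> L2 \<Omega>"
  shows "has_weak_partial \<Omega> i (\<lambda>x. a *\<^sub>R v x + b *\<^sub>R w x) (\<lambda>x. a *\<^sub>R g x + b *\<^sub>R h x)"
  unfolding has_weak_partial_def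
proof
  fix \<phi> assume \<phi>: "\<phi> \<in> test_functions \<Omega>"
  then show "L2_inner \<Omega> (\<lambda>x. a *\<^sub>R v x + b *\<^sub>R w x) (partial_deriv i \<phi>) =
      - L2_inner \<Omega> (\<lambda>x. a *\<^sub>R g x + b *\<^sub>R h x) \<phi>"
    using assms(5,6) assms(7)[OF \<phi>] assms(1-4)
    by (subst (1 2) L2_inner_lincomb) (auto simp: has_weak_partial_def)
qed

lemma weak_partial:
  assumes "v \<in> H1 \<Omega>"
  shows "weak_partial \<Omega> i v \<in> L2 \<Omega>" "has_weak_partial \<Omega> i v (weak_partial \<Omega> i v)"
proof -
  have "\<exists>g. g \<in> L2 \<Omega> \<and> has_weak_partial \<Omega> i v g"
    using assms by (auto simp: H1_def)
  from someI_ex[OF this]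
  show "weak_partial \<Omega> i v \<in> L2 \<Omega>" "has_weak_partial \<Omega> i v (weak_partial \<Omega> i v)"
    unfolding weak_partial_def by blast+
qed

text \<open>Linearity of \<open>dvg\<close> is a matter of weak derivatives alone. On this larger
  space closure under linear combinations follows from that of \<open>L2\<close>, with no
  approximation by test functions.\<close>

definition H1_vec :: "(real ^ 'd) set \<Rightarrow> 'd vector_field set" where
  "H1_vec \<Omega> = {v. \<forall>i. (\<lambda>x. v x $ i) \<in> H1 \<Omega>}"

lemma H10_vec_subset_H1_vec: "H10_vec \<Omega> \<subseteq> H1_vec \<Omega>"
  by (auto simp: H10_vec_def H1_vec_def H10_def)

lemma H1_vec_L2:
  assumes "v \<in> H1_vec \<Omega>"
  shows "v \<in> L2 \<Omega>"
  using assms by (auto simp: H1_vec_def H1_def intro: L2_vec)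

lemma dvg_L2:
  assumes "v \<in> H1_vec \<Omega>"
  shows "dvg \<Omega> v \<in> L2 \<Omega>"
  unfolding dvg_def using assms by (intro L2_sum weak_partial) (auto simp: H1_vec_def)

section \<open>Uniqueness of weak derivatives and the dual norm on a bounded open set\<close>

locale bounded_domain =
  fixes \<Omega> :: "(real ^ 'd) set"
  assumes open_domain: "open \<Omega>" and bounded_domain: "bounded \<Omega>"
begin

text \<open>The closure of \<open>\<Omega>\<close> is compact, so \<open>\<phi>\<close> is bounded
  on it, and \<open>\<Omega>\<close> has finite measure.\<close>

lemma continuous_L2:
  fixes \<phi> :: "real ^ 'd \<Rightarrow> real"
  assumes "continuous_on UNIV \<phi>"
  shows "\<phi> \<in> L2 \<Omega>"
proof -
  have \<Omega>: "\<Omega> \<in> sets lebesgue" "\<Omega> \<in> lmeasurable"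
    using open_domain bounded_domain by (auto intro: lmeasurable_open)
  have meas: "\<phi> \<in> borel_measurable (lebesgue_on \<Omega>)"
    using continuous_imp_measurable_on_sets_lebesgue[OF continuous_on_subset[OF assms] \<Omega>(1)] by auto
  have "compact (\<phi> ` closure \<Omega>)"
    using bounded_domain assms by (intro compact_continuous_image) (auto intro: continuous_on_subset)
  then obtain K where K: "\<And>x. x \<in> closure \<Omega> \<Longrightarrow> \<bar>\<phi> x\<bar> \<le> K"
    using compact_imp_bounded bounded_real by (metis image_eqI)
  interpret finite_measure "lebesgue_on \<Omega>"
    using \<Omega>(2) by (rule finite_measure_lebesgue_on)
  have "integrable (lebesgue_on \<Omega>) (\<lambda>x. (norm (\<phi> x))\<^sup>2)"
  proof (rule integrable_const_bound[where B = "K\<^sup>2"])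
    show "AE x in lebesgue_on \<Omega>. norm ((norm (\<phi> x))\<^sup>2) \<le> K\<^sup>2"
    proof (rule AE_I2)
      fix x assume "x \<in> space (lebesgue_on \<Omega>)"
      then have "\<bar>\<phi> x\<bar> \<le> K"
        using K closure_subset[of \<Omega>] by auto
      then show "norm ((norm (\<phi> x))\<^sup>2) \<le> K\<^sup>2"
        using power_mono[of "\<bar>\<phi> x\<bar>" K 2] by simp
    qed
  qed (use meas in simp)
  then show ?thesis
    using meas by (simp add: L2_def)
qed

lemma test_function_L2:
  assumes "\<phi> \<in> test_functions \<Omega>"
  shows "\<phi> \<in> L2 \<Omega> \<and> partial_deriv i \<phi> \<in> L2 \<Omega>"
  using continuous_L2 test_function_continuous[OF assms] by blast

lemma weak_partial_unique:
  assumes "has_weak_partial \<Omega> i v g" "has_weak_partial \<Omega> i v h" "g \<in> L2 \<Omega>" "h \<in> L2 \<Omega>"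
  shows "AE x in lebesgue_on \<Omega>. g x = h x"
proof -
  let ?d = "\<lambda>x. 1 *\<^sub>R g x + (-1) *\<^sub>R h x"
  have d: "?d \<in> L2 \<Omega>"
    using assms by (intro L2_lincomb)
  have "AE x in lebesgue_on \<Omega>. ?d x = 0"
  proof (rule fundamental_lemma[OF open_domain])
    \<comment> \<open>The constant 1 is square integrable on \<open>\<Omega>\<close>, so
      integrability of \<open>?d\<close> is that of its product with 1.\<close>
    show "integrable (lebesgue_on \<Omega>) ?d"
      using L2_integrable_inner[OF d continuous_L2[of "\<lambda>_. 1"]] by simp
    fix \<phi> assume "\<phi> \<in> test_functions \<Omega>"
    then show "L2_inner \<Omega> ?d \<phi> = 0"
      using assms test_function_L2 by (subst L2_inner_lincomb) (auto simp: has_weak_partial_def)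
  qed
  then show ?thesis by simp
qed

text \<open>Combining the chosen representatives gives one weak derivative of the combination, and
  \<open>weak_partial\<close> picks another; uniqueness identifies them up to a null set.\<close>

lemma weak_partial_lincomb:
  assumes v: "v \<in> H1 \<Omega>" and w: "w \<in> H1 \<Omega>"
  shows "(\<lambda>x. a *\<^sub>R v x + b *\<^sub>R w x) \<in> H1 \<Omega>"
    and "AE x in lebesgue_on \<Omega>. weak_partial \<Omega> i (\<lambda>x. a *\<^sub>R v x + b *\<^sub>R w x) x =
        a *\<^sub>R weak_partial \<Omega> i v x + b *\<^sub>R weak_partial \<Omega> i w x"
proof -
  let ?g = "\<lambda>i x. a *\<^sub>R weak_partial \<Omega> i v x + b *\<^sub>R weak_partial \<Omega> i w x"
  have L2: "v \<in> L2 \<Omega>" "w \<in> L2 \<Omega>"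
    using v w by (auto simp: H1_def)
  have g: "?g i \<in> L2 \<Omega>" for i
    using weak_partial v w by (intro L2_lincomb)
  have wp: "has_weak_partial \<Omega> i (\<lambda>x. a *\<^sub>R v x + b *\<^sub>R w x) (?g i)" for i
    using L2 weak_partial v w test_function_L2 by (intro has_weak_partial_lincomb) auto
  show H1: "(\<lambda>x. a *\<^sub>R v x + b *\<^sub>R w x) \<in> H1 \<Omega>"
    using L2_lincomb[OF L2] g wp unfolding H1_def by blast
  show "AE x in lebesgue_on \<Omega>. weak_partial \<Omega> i (\<lambda>x. a *\<^sub>R v x + b *\<^sub>R w x) x = ?g i x"
    by (rule weak_partial_unique[OF weak_partial(2)[OF H1] wp weak_partial(1)[OF H1] g])
qed

lemma dvg_lincomb:
  assumes "v \<in> H1_vec \<Omega>" "w \<in> H1_vec \<Omega>"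
  shows "(\<lambda>x. a *\<^sub>R v x + b *\<^sub>R w x) \<in> H1_vec \<Omega>"
    and "AE x in lebesgue_on \<Omega>. dvg \<Omega> (\<lambda>x. a *\<^sub>R v x + b *\<^sub>R w x) x = a *\<^sub>R dvg \<Omega> v x + b *\<^sub>R dvg \<Omega> w x"
proof -
  have H1: "(\<lambda>x. v x $ i) \<in> H1 \<Omega>" "(\<lambda>x. w x $ i) \<in> H1 \<Omega>" for i
    using assms by (auto simp: H1_vec_def)
  note lin = weak_partial_lincomb[OF H1]
  show "(\<lambda>x. a *\<^sub>R v x + b *\<^sub>R w x) \<in> H1_vec \<Omega>"
    using lin(1) by (simp add: H1_vec_def)
  have "AE x in lebesgue_on \<Omega>. \<forall>i. weak_partial \<Omega> i (\<lambda>y. a *\<^sub>R (v y $ i) + b *\<^sub>R (w y $ i)) x =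
      a *\<^sub>R weak_partial \<Omega> i (\<lambda>y. v y $ i) x + b *\<^sub>R weak_partial \<Omega> i (\<lambda>y. w y $ i) x"
    using lin(2) by (simp add: eventually_all_finite)
  then show "AE x in lebesgue_on \<Omega>. dvg \<Omega> (\<lambda>x. a *\<^sub>R v x + b *\<^sub>R w x) x = a *\<^sub>R dvg \<Omega> v x + b *\<^sub>R dvg \<Omega> w x"
    by (rule eventually_mono) (simp add: dvg_def sum.distrib sum_distrib_left)
qed

lemma L2_inner_dvg_lincomb:
  assumes "v \<in> H1_vec \<Omega>" "w \<in> H1_vec \<Omega>" "q \<in> L2 \<Omega>"
  shows "L2_inner \<Omega> (dvg \<Omega> (\<lambda>x. a *\<^sub>R v x + b *\<^sub>R w x)) q =
    a * L2_inner \<Omega> (dvg \<Omega> v) q + b * L2_inner \<Omega> (dvg \<Omega> w) q"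
proof -
  have "L2_inner \<Omega> (dvg \<Omega> (\<lambda>x. a *\<^sub>R v x + b *\<^sub>R w x)) q =
      L2_inner \<Omega> (\<lambda>x. a *\<^sub>R dvg \<Omega> v x + b *\<^sub>R dvg \<Omega> w x) q"
    using assms by (intro L2_inner_cong_AE dvg_lincomb dvg_L2 L2_lincomb)
  then show ?thesis
    using assms by (simp add: L2_inner_lincomb dvg_L2 flip: real_scaleR_def)
qed

text \<open>The supremum in \<open>Hm1_norm\<close> ranges over functions with nonzero L2 norm; by
  contraposition, every function with nonzero gradient norm belongs to that range. A function
  vanishing almost everywhere has 0 as a weak derivative, so uniqueness applies.\<close>

lemma grad_norm_eq_0:
  assumes v: "v \<in> H1_vec \<Omega>" and 0: "L2_norm \<Omega> v = 0"
  shows "L2_norm \<Omega> (grad \<Omega> v) = 0"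
proof -
  have v0: "AE x in lebesgue_on \<Omega>. v x = 0"
    using L2_norm_eq_0_AE H1_vec_L2 assms by blast
  have "AE x in lebesgue_on \<Omega>. weak_partial \<Omega> j (\<lambda>y. v y $ i) x = 0" for i j
  proof (rule weak_partial_unique)
    have H1: "(\<lambda>y. v y $ i) \<in> H1 \<Omega>"
      using v by (auto simp: H1_vec_def)
    then show "has_weak_partial \<Omega> j (\<lambda>y. v y $ i) (weak_partial \<Omega> j (\<lambda>y. v y $ i))"
      "weak_partial \<Omega> j (\<lambda>y. v y $ i) \<in> L2 \<Omega>"
      using weak_partial by blast+
    have "L2_inner \<Omega> (\<lambda>y. v y $ i) \<psi> = 0" for \<psi>
      unfolding L2_inner_def by (rule integral_eq_zero_AE) (use v0 in \<open>auto elim!: eventually_mono\<close>)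
    then show "has_weak_partial \<Omega> j (\<lambda>y. v y $ i) (\<lambda>_. 0)"
      by (simp add: has_weak_partial_def L2_inner_def)
    show "(\<lambda>_. 0) \<in> L2 \<Omega>"
      by (simp add: L2_def)
  qed
  then have "AE x in lebesgue_on \<Omega>. \<forall>i j. weak_partial \<Omega> j (\<lambda>y. v y $ i) x = 0"
    by (simp add: eventually_all_finite)
  then have "AE x in lebesgue_on \<Omega>. grad \<Omega> v x \<bullet> grad \<Omega> v x = 0"
    by (rule eventually_mono) (simp add: grad_def vec_eq_iff)
  then show ?thesis
    unfolding L2_norm_def L2_inner_def by (simp add: integral_eq_zero_AE)
qed

text \<open>Duality bound followed by Young's inequality with weight \<open>\<nu>\<close>. If the
  gradient norm of \<open>v\<close> is 0, continuity of \<open>g\<close> already forces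
  \<open>g v = 0\<close>.\<close>

lemma Hm1_young:
  assumes g: "g \<in> Hm1 \<Omega>" and v: "v \<in> H10_vec \<Omega>" and \<nu>: "\<nu> > 0"
  shows "g v \<le> (Hm1_norm \<Omega> g)\<^sup>2 / (2 * \<nu>) + \<nu> / 2 * (L2_norm \<Omega> (grad \<Omega> v))\<^sup>2"
proof -
  let ?G = "\<lambda>v. L2_norm \<Omega> (grad \<Omega> v)"
  obtain C where C: "\<And>v. v \<in> H10_vec \<Omega> \<Longrightarrow> \<bar>g v\<bar> \<le> C * ?G v"
    using g unfolding Hm1_def by blast
  have "g v \<le> Hm1_norm \<Omega> g * ?G v"
  proof (cases "?G v = 0")
    case True
    then show ?thesis using C[OF v] by simp
  next
    case False
    then have G: "?G v > 0"
      using L2_norm_nonneg[of \<Omega> "grad \<Omega> v"] by linarith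
    have "g v / ?G v \<le> Hm1_norm \<Omega> g"
      unfolding Hm1_norm_def
    proof (rule cSUP_upper)
      show "v \<in> {v \<in> H10_vec \<Omega>. L2_norm \<Omega> v \<noteq> 0}"
        using False v grad_norm_eq_0 H10_vec_subset_H1_vec by auto
      show "bdd_above ((\<lambda>v. g v / ?G v) ` {v \<in> H10_vec \<Omega>. L2_norm \<Omega> v \<noteq> 0})"
      proof (rule bdd_aboveI2)
        fix w assume w: "w \<in> {v \<in> H10_vec \<Omega>. L2_norm \<Omega> v \<noteq> 0}"
        \<comment> \<open>Division by zero yields 0, so a quotient with \<open>?G w = 0\<close> is
          bounded by 0 and every other one by \<open>C\<close>.\<close>
        show "g w / ?G w \<le> max C 0"
        proof (cases "?G w = 0")
          case False
          then have "?G w > 0"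
            using L2_norm_nonneg[of \<Omega> "grad \<Omega> w"] by linarith
          then show ?thesis
            using C[of w] w by (auto simp: le_max_iff_disj divide_le_eq)
        qed simp
      qed
    qed
    then show ?thesis
      using G by (simp add: divide_le_eq)
  qed
  also have "\<dots> \<le> (Hm1_norm \<Omega> g)\<^sup>2 / (2 * \<nu>) + \<nu> / 2 * (?G v)\<^sup>2"
  proof -
    have "0 \<le> (Hm1_norm \<Omega> g - \<nu> * ?G v)\<^sup>2 / (2 * \<nu>)"
      using \<nu> by simp
    also have "\<dots> = (Hm1_norm \<Omega> g)\<^sup>2 / (2 * \<nu>) + \<nu> / 2 * (?G v)\<^sup>2 - Hm1_norm \<Omega> g * ?G v"
      using \<nu> by (simp add: field_simps power2_eq_square)
    finally show ?thesis by simp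
  qed
  finally show ?thesis .
qed

end

lemma bounded_polyhedral_domain_imp_bounded_domain:
  assumes "bounded_polyhedral_domain \<Omega>"
  shows "bounded_domain \<Omega>"
proof
  obtain \<P> where P: "finite \<P>" "\<forall>P\<in>\<P>. polytope P" "\<Omega> = interior (\<Union>\<P>)"
    using assms by (auto simp: bounded_polyhedral_domain_def)
  then show "open \<Omega>" by simp
  have "bounded (\<Union>\<P>)"
    using P polytope_imp_bounded by blast
  then show "bounded \<Omega>"
    using P interior_subset bounded_subset by blast
qed

section \<open>The BDF2 energy method for semi-inner products\<close>

lemma finite_dim_space_lincomb:
  assumes "finite_dim_space V" "v \<in> V" "w \<in> V"
  shows "(\<lambda>x. a *\<^sub>R v x + b *\<^sub>R w x) \<in> V"
proof -
  obtain B where V: "V = {(\<lambda>x. \<Sum>b\<in>B. c b *\<^sub>R b x) | c. True}"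
    using assms by (auto simp: finite_dim_space_def)
  obtain c d where "v = (\<lambda>x. \<Sum>b\<in>B. c b *\<^sub>R b x)" "w = (\<lambda>x. \<Sum>b\<in>B. d b *\<^sub>R b x)"
    using assms V by auto
  then have "(\<lambda>x. a *\<^sub>R v x + b *\<^sub>R w x) = (\<lambda>x. \<Sum>e\<in>B. (a * c e + b * d e) *\<^sub>R e x)"
    by (simp add: scaleR_sum_right sum.distrib scaleR_add_left)
  then show ?thesis unfolding V by (auto intro!: exI[of _ "\<lambda>e. a * c e + b * d e"])
qed

text \<open>Instantiated below with the L2 product of functions and with the L2 product of their
  divergences. The second may vanish on nonzero functions, so only semidefiniteness is asked.
  Linearity is confined to \<open>V\<close>, where the integrals converge.\<close>

locale semi_inner_form =
  fixes V :: "('a \<Rightarrow> 'b::real_vector) set" and B :: "('a \<Rightarrow> 'b) \<Rightarrow> ('a \<Rightarrow> 'b) \<Rightarrow> real"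
  assumes lincomb_mem: "v \<in> V \<Longrightarrow> w \<in> V \<Longrightarrow> (\<lambda>x. a *\<^sub>R v x + b *\<^sub>R w x) \<in> V"
    and lincomb: "v \<in> V \<Longrightarrow> w \<in> V \<Longrightarrow> z \<in> V \<Longrightarrow>
      B (\<lambda>x. a *\<^sub>R v x + b *\<^sub>R w x) z = a * B v z + b * B w z"
    and sym: "B v w = B w v"
    and nonneg: "B v v \<ge> 0"
begin

lemma lincomb3_mem:
  assumes "u \<in> V" "v \<in> V" "w \<in> V"
  shows "(\<lambda>x. a *\<^sub>R u x + b *\<^sub>R v x + c *\<^sub>R w x) \<in> V"
  using lincomb_mem[OF lincomb_mem[OF assms(1,2)] assms(3), of 1 a b c] by simp

lemma lincomb3:
  assumes "u \<in> V" "v \<in> V" "w \<in> V" "z \<in> V"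
  shows "B (\<lambda>x. a *\<^sub>R u x + b *\<^sub>R v x + c *\<^sub>R w x) z = a * B u z + b * B v z + c * B w z"
  using lincomb[OF lincomb_mem[OF assms(1,2)] assms(3,4), of 1 a b c] lincomb[OF assms(1,2,4), of a b]
  by simp

lemma lincomb3_self:
  assumes "u \<in> V" "v \<in> V" "w \<in> V"
  shows "B (\<lambda>x. a *\<^sub>R u x + b *\<^sub>R v x + c *\<^sub>R w x) (\<lambda>x. a *\<^sub>R u x + b *\<^sub>R v x + c *\<^sub>R w x) =
    a\<^sup>2 * B u u + b\<^sup>2 * B v v + c\<^sup>2 * B w w + 2 * a * b * B u v + 2 * a * c * B u w + 2 * b * c * B v w"
proof -
  let ?s = "\<lambda>x. a *\<^sub>R u x + b *\<^sub>R v x + c *\<^sub>R w x"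
  have "B z ?s = a * B z u + b * B z v + c * B z w" if "z \<in> V" for z
    using lincomb3[OF assms that, of a b c] by (simp add: sym[of z])
  then show ?thesis
    using lincomb3[OF assms lincomb3_mem[OF assms], of a b c a b c] assms sym[of v u] sym[of w u] sym[of w v]
    by (simp add: algebra_simps power2_eq_square)
qed

text \<open>The G-norm of BDF2: the quadratic form with matrix rows (5, -2) and (-2, 1), as
  \<open>bdf2_energy_eq\<close> shows.\<close>

definition bdf2_energy :: "('a \<Rightarrow> 'b) \<Rightarrow> ('a \<Rightarrow> 'b) \<Rightarrow> real" where
  "bdf2_energy v w = B v v + B (\<lambda>x. 2 *\<^sub>R v x - w x) (\<lambda>x. 2 *\<^sub>R v x - w x)"

lemma bdf2_energy_eq:
  assumes "v \<in> V" "w \<in> V"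
  shows "bdf2_energy v w = 5 * B v v + B w w - 4 * B v w"
  using lincomb3_self[OF assms(1,2,2), of 2 "-1" 0] by (simp add: bdf2_energy_def)

text \<open>G-stability of BDF2. Both sides expand to the same quadratic form in \<open>u0\<close>,
  \<open>u1\<close>, \<open>u2\<close>; the last term is the square of the second difference, so
  testing with \<open>u2\<close> controls the energy increment.\<close>

lemma bdf2_identity:
  assumes "u0 \<in> V" "u1 \<in> V" "u2 \<in> V"
  shows "2 * (3 * B u2 u2 - 4 * B u1 u2 + B u0 u2) = bdf2_energy u2 u1 - bdf2_energy u1 u0 +
    B (\<lambda>x. 1 *\<^sub>R u2 x + (-2) *\<^sub>R u1 x + 1 *\<^sub>R u0 x) (\<lambda>x. 1 *\<^sub>R u2 x + (-2) *\<^sub>R u1 x + 1 *\<^sub>R u0 x)"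
  using lincomb3_self[OF assms(3,2,1), of 1 "-2" 1] bdf2_energy_eq assms
    sym[of u1 u0] sym[of u2 u0] sym[of u2 u1]
  by simp

end

text \<open>\<open>A\<close> and \<open>B\<close> model the L2 products of functions and of
  divergences, \<open>G\<close> the squared gradient norm of \<open>uh\<close>, and \<open>F\<close>
  its pairing with the force. Step 1 enters already tested with \<open>uh\<close> and freed of its
  convective and pressure terms; Step 2 stays general because two test functions are
  inserted.\<close>

lemma bdf2_step_energy:
  fixes A B :: "('a \<Rightarrow> 'b::real_vector) \<Rightarrow> ('a \<Rightarrow> 'b) \<Rightarrow> real"
  assumes "semi_inner_form V A" "semi_inner_form V B"
    and V: "u0 \<in> V" "u1 \<in> V" "u2 \<in> V" "uh \<in> V"
    and pos: "\<tau> > 0" "\<beta> \<ge> 0" "\<gamma> \<ge> 0"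
    and step1: "A (\<lambda>x. (1 / (2 * \<tau>)) *\<^sub>R (3 *\<^sub>R uh x - 4 *\<^sub>R u1 x + u0 x)) uh + \<nu> * G = F"
    and step2: "\<And>v. v \<in> V \<Longrightarrow> A (\<lambda>x. (1 / (2 * \<tau>)) *\<^sub>R (3 *\<^sub>R u2 x - 3 *\<^sub>R uh x)) v
        + \<beta> * B (\<lambda>x. (1 / (2 * \<tau>)) *\<^sub>R (3 *\<^sub>R u2 x - 4 *\<^sub>R u1 x + u0 x)) v + \<gamma> * B u2 v = 0"
  shows "semi_inner_form.bdf2_energy A u2 u1 + (2 * \<gamma> * \<tau> / 3 + \<beta>) * semi_inner_form.bdf2_energy B u2 u1
      + 4 * \<gamma> * \<tau> * B u2 u2 + 4 * \<nu> * \<tau> * G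
    \<le> 4 * \<tau> * F + semi_inner_form.bdf2_energy A u1 u0
      + (2 * \<gamma> * \<tau> / 3 + \<beta>) * semi_inner_form.bdf2_energy B u1 u0"
proof -
  interpret A: semi_inner_form V A by fact
  interpret B: semi_inner_form V B by fact
  \<comment> \<open>The BDF2 difference without its factor \<open>1 / (2 * \<tau>)\<close>. As a
    test function in Step 2 it turns the \<open>\<beta>\<close> term into the square
    \<open>B W W\<close> and pairs \<open>u2\<close> and \<open>uh\<close> with BDF2
    differences.\<close>
  define W where "W = (\<lambda>x. 3 *\<^sub>R u2 x + (-4) *\<^sub>R u1 x + 1 *\<^sub>R u0 x)"
  have W: "W \<in> V"
    unfolding W_def using V by (intro A.lincomb3_mem)
  have s: "(\<lambda>x. (1 / (2 * \<tau>)) *\<^sub>R (3 *\<^sub>R w x - 4 *\<^sub>R u1 x + u0 x)) =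
      (\<lambda>x. (3 / (2 * \<tau>)) *\<^sub>R w x + (- 4 / (2 * \<tau>)) *\<^sub>R u1 x + (1 / (2 * \<tau>)) *\<^sub>R u0 x)" for w :: "'a \<Rightarrow> 'b"
    by (simp add: scaleR_add_right scaleR_diff_right)
  have t: "(\<lambda>x. (1 / (2 * \<tau>)) *\<^sub>R (3 *\<^sub>R u2 x - 3 *\<^sub>R uh x)) =
      (\<lambda>x. (3 / (2 * \<tau>)) *\<^sub>R u2 x + (- 3 / (2 * \<tau>)) *\<^sub>R uh x)"
    by (simp add: scaleR_diff_right)
  have S1: "3 * A uh uh - 4 * A u1 uh + A u0 uh + 2 * \<tau> * \<nu> * G = 2 * \<tau> * F"
  proof -
    have "3 * A uh uh - 4 * A u1 uh + A u0 uh + 2 * \<tau> * \<nu> * G =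
        2 * \<tau> * ((3 / (2 * \<tau>)) * A uh uh + (- 4 / (2 * \<tau>)) * A u1 uh + (1 / (2 * \<tau>)) * A u0 uh + \<nu> * G)"
      using pos by (simp add: field_simps)
    also have "\<dots> = 2 * \<tau> * F"
      using step1 V unfolding s by (simp only: A.lincomb3)
    finally show ?thesis .
  qed
  have S2: "3 * (A u2 v - A uh v) + \<beta> * (3 * B u2 v - 4 * B u1 v + B u0 v) + 2 * \<tau> * \<gamma> * B u2 v = 0"
    if "v \<in> V" for v
  proof -
    have "3 * (A u2 v - A uh v) + \<beta> * (3 * B u2 v - 4 * B u1 v + B u0 v) + 2 * \<tau> * \<gamma> * B u2 v =
        2 * \<tau> * ((3 / (2 * \<tau>)) * A u2 v + (- 3 / (2 * \<tau>)) * A uh v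
          + \<beta> * ((3 / (2 * \<tau>)) * B u2 v + (- 4 / (2 * \<tau>)) * B u1 v + (1 / (2 * \<tau>)) * B u0 v) + \<gamma> * B u2 v)"
      using pos by (simp add: field_simps)
    also have "\<dots> = 2 * \<tau> * 0"
      using step2[OF that] V that unfolding s t by (simp only: A.lincomb B.lincomb3)
    finally show ?thesis by simp
  qed
  have AW: "A z W = 3 * A u2 z - 4 * A u1 z + A u0 z" if "z \<in> V" for z
    using A.lincomb3[OF V(3,2,1) that, of 3 "-4" 1, folded W_def]
      A.sym[of z W] by linarith
  have BW: "3 * B u2 W - 4 * B u1 W + B u0 W = B W W"
    using B.lincomb3[OF V(3,2,1) W, of 3 "-4" 1, folded W_def] by linarith
  have B2W: "B u2 W = 3 * B u2 u2 - 4 * B u1 u2 + B u0 u2"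
    using B.lincomb3[OF V(3,2,1) V(3), of 3 "-4" 1, folded W_def] B.sym[of u2 W] by linarith
  \<comment> \<open>The coefficient 0 pads \<open>uh - u2\<close> to the three-term shape of
    \<open>lincomb3_self\<close>.\<close>
  have Auh: "A (\<lambda>x. 1 *\<^sub>R uh x + (-1) *\<^sub>R u2 x + 0 *\<^sub>R u2 x) (\<lambda>x. 1 *\<^sub>R uh x + (-1) *\<^sub>R u2 x + 0 *\<^sub>R u2 x) =
      A uh uh + A u2 u2 - 2 * A uh u2"
    using A.lincomb3_self[OF V(4,3,3), of 1 "-1" 0] by simp
  let ?b = "3 * B u2 u2 - 4 * B u1 u2 + B u0 u2"
  have E2: "3 * (A u2 u2 - A uh u2) + \<beta> * ?b + 2 * \<tau> * \<gamma> * B u2 u2 = 0"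
    using S2[OF V(3)] .
  have EW: "3 * (3 * A u2 u2 - 4 * A u1 u2 + A u0 u2 - (3 * A uh u2 - 4 * A u1 uh + A u0 uh))
      + \<beta> * B W W + 2 * \<tau> * \<gamma> * ?b = 0"
    using S2[OF W, unfolded BW] A.sym[of u2 uh] by (simp only: AW V B2W)
  \<comment> \<open>With \<open>2 * \<tau>\<close> cleared, this adds twice Step 1, twice Step 2
    tested with \<open>u2\<close>, and 2/3 of Step 2 tested with \<open>W\<close>. The products of
    \<open>uh\<close> with \<open>u1\<close> and \<open>u0\<close> cancel, and those of
    \<open>uh\<close> and \<open>u2\<close> complete the square of \<open>uh - u2\<close>. The
    factor \<open>?b\<close> comes with \<open>\<beta>\<close> from the test with \<open>u2\<close>
    and with \<open>\<gamma>\<close> from the test with \<open>W\<close>, whence the weight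
    \<open>2 * \<gamma> * \<tau> / 3 + \<beta>\<close>.\<close>
  have "2 * (3 * A u2 u2 - 4 * A u1 u2 + A u0 u2) + (2 * \<gamma> * \<tau> / 3 + \<beta>) * (2 * ?b)
      + 6 * (A uh uh + A u2 u2 - 2 * A uh u2) + 2 / 3 * (\<beta> * B W W)
      + 4 * \<gamma> * \<tau> * B u2 u2 + 4 * \<nu> * \<tau> * G =
    2 * (3 * A uh uh - 4 * A u1 uh + A u0 uh + 2 * \<tau> * \<nu> * G)
      + 2 * (3 * (A u2 u2 - A uh u2) + \<beta> * ?b + 2 * \<tau> * \<gamma> * B u2 u2)
      + 2 / 3 * (3 * (3 * A u2 u2 - 4 * A u1 u2 + A u0 u2 - (3 * A uh u2 - 4 * A u1 uh + A u0 uh))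
        + \<beta> * B W W + 2 * \<tau> * \<gamma> * ?b)"
    by (simp add: field_simps)
  then have key: "2 * (3 * A u2 u2 - 4 * A u1 u2 + A u0 u2) + (2 * \<gamma> * \<tau> / 3 + \<beta>) * (2 * ?b)
      + 6 * (A uh uh + A u2 u2 - 2 * A uh u2) + 2 / 3 * (\<beta> * B W W)
      + 4 * \<gamma> * \<tau> * B u2 u2 + 4 * \<nu> * \<tau> * G = 4 * \<tau> * F"
    unfolding S1 E2 EW by simp
  have "0 \<le> 6 * (A uh uh + A u2 u2 - 2 * A uh u2)"
    unfolding Auh[symmetric] using A.nonneg by simp
  moreover have "0 \<le> 2 / 3 * (\<beta> * B W W)"
    using B.nonneg pos by simp
  moreover have "2 * (3 * A u2 u2 - 4 * A u1 u2 + A u0 u2) \<ge> A.bdf2_energy u2 u1 - A.bdf2_energy u1 u0"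
    unfolding A.bdf2_identity[OF V(1-3)] using A.nonneg by simp
  moreover have "(2 * \<gamma> * \<tau> / 3 + \<beta>) * (2 * ?b) \<ge> (2 * \<gamma> * \<tau> / 3 + \<beta>) * (B.bdf2_energy u2 u1 - B.bdf2_energy u1 u0)"
    unfolding B.bdf2_identity[OF V(1-3)] using B.nonneg pos by (intro mult_left_mono) auto
  ultimately show ?thesis
    using key by (simp only: right_diff_distrib)
qed

section \<open>The stability estimate for BDF2-mgd\<close>

theorem theorem3p3:
  fixes \<Omega> :: "(real ^ 'd) set"
    and Xh :: "'d vector_field set" and Qh :: "'d scalar_field set"
    and C0 \<nu> \<beta> \<gamma> T \<Delta>t :: real and N :: nat
    and f :: "real \<Rightarrow> 'd functional"
    and u uhat :: "nat \<Rightarrow> 'd vector_field" and p :: "nat \<Rightarrow> 'd scalar_field"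
  assumes "CARD('d) = 2 \<or> CARD('d) = 3"
    and "bounded_polyhedral_domain \<Omega>"
    and "finite_dim_space Xh" and "Xh \<subseteq> H10_vec \<Omega>"
    and "finite_dim_space Qh" and "Qh \<subseteq> L2_mean_zero \<Omega>"
    and "C0 > 0" and "inf_sup_const \<Omega> Xh Qh \<ge> ereal C0"
    and "\<nu> > 0" and "\<beta> \<ge> 0" and "\<gamma> \<ge> 0"
    and "T > 0" and "N \<ge> 1" and "\<Delta>t = T / real N"
    and "f \<in> L2_time_Hm1 \<Omega> T"
    and "\<And>n. n \<le> N \<Longrightarrow> f (real n * \<Delta>t) \<in> Hm1 \<Omega>"
    and "u 0 \<in> Xh" and "u 1 \<in> Xh"
    and "BDF2_mgd \<Omega> Xh Qh \<nu> \<beta> \<gamma> \<Delta>t N (\<lambda>n. f (real n * \<Delta>t)) u uhat p"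
  shows
    "(L2_norm \<Omega> (u N))\<^sup>2
      + (L2_norm \<Omega> (\<lambda>x. 2 *\<^sub>R u N x - u (N-1) x))\<^sup>2
      + (2 * \<gamma> * \<Delta>t / 3 + \<beta>) * (L2_norm \<Omega> (dvg \<Omega> (u N)))\<^sup>2
      + (2 * \<gamma> * \<Delta>t / 3 + \<beta>) * (L2_norm \<Omega> (dvg \<Omega> (\<lambda>x. 2 *\<^sub>R u N x - u (N-1) x)))\<^sup>2
      + 4 * \<gamma> * \<Delta>t * (\<Sum>n=1..N-1. (L2_norm \<Omega> (dvg \<Omega> (u (n+1))))\<^sup>2)
      + 2 * \<nu> * \<Delta>t * (\<Sum>n=1..N-1. (L2_norm \<Omega> (grad \<Omega> (uhat (n+1))))\<^sup>2)
     \<le> 2 * \<Delta>t / \<nu> * (\<Sum>n=1..N-1. (Hm1_norm \<Omega> (f (real (n+1) * \<Delta>t)))\<^sup>2)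
      + (L2_norm \<Omega> (u 1))\<^sup>2
      + (L2_norm \<Omega> (\<lambda>x. 2 *\<^sub>R u 1 x - u 0 x))\<^sup>2
      + (2 * \<gamma> * \<Delta>t / 3 + \<beta>) * (L2_norm \<Omega> (dvg \<Omega> (u 1)))\<^sup>2
      + (2 * \<gamma> * \<Delta>t / 3 + \<beta>) * (L2_norm \<Omega> (dvg \<Omega> (\<lambda>x. 2 *\<^sub>R u 1 x - u 0 x)))\<^sup>2"
proof -
  interpret bounded_domain \<Omega>
    using assms(2) by (rule bounded_polyhedral_domain_imp_bounded_domain)
  let ?A = "\<lambda>v w. L2_inner \<Omega> v w" and ?B = "\<lambda>v w. L2_inner \<Omega> (dvg \<Omega> v) (dvg \<Omega> w)"
  have H1: "v \<in> H1_vec \<Omega>" if "v \<in> Xh" for v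
    using that \<open>Xh \<subseteq> H10_vec \<Omega>\<close> H10_vec_subset_H1_vec by blast
  have A: "semi_inner_form Xh ?A"
    using finite_dim_space_lincomb[OF \<open>finite_dim_space Xh\<close>] H1
    by unfold_locales (assumption | rule L2_inner_lincomb L2_inner_commute H1_vec_L2 L2_inner_self_nonneg)+
  have B: "semi_inner_form Xh ?B"
    using finite_dim_space_lincomb[OF \<open>finite_dim_space Xh\<close>] H1
    by unfold_locales (assumption | rule L2_inner_dvg_lincomb L2_inner_commute dvg_L2 L2_inner_self_nonneg)+
  interpret A: semi_inner_form Xh ?A by (rule A)
  interpret B: semi_inner_form Xh ?B by (rule B)
  have \<Delta>t: "\<Delta>t > 0"
    using assms by simp
  have step: "mgd_step1 \<Omega> Xh Qh \<nu> \<Delta>t (f (real (n + 1) * \<Delta>t)) (u (n-1)) (u n) (uhat (n+1)) (p (n+1))"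
    "mgd_step2 \<Omega> Xh \<beta> \<gamma> \<Delta>t (u (n-1)) (u n) (uhat (n+1)) (u (n+1))" if "n \<in> {1..N-1}" for n
    using assms(19) that unfolding BDF2_mgd_def by blast+
  have u_mem: "u n \<in> Xh" if "n \<le> N" for n
  proof (cases "n \<le> 1")
    case True
    then show ?thesis using assms(17,18) by (cases n) auto
  next
    case False
    then have "n - 1 \<in> {1..N-1}" "n - 1 + 1 = n"
      using that by auto
    then show ?thesis
      using step(2) unfolding mgd_step2_def by metis
  qed
  \<comment> \<open>\<open>E\<close> is used only for indices at least 1, so \<open>n - 1\<close> is
    never truncated; \<open>E 1\<close> is the initial energy.\<close>
  define E where "E n = A.bdf2_energy (u n) (u (n-1)) + (2 * \<gamma> * \<Delta>t / 3 + \<beta>) * B.bdf2_energy (u n) (u (n-1))" for n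
  define D where "D n = (L2_norm \<Omega> (dvg \<Omega> (u (n+1))))\<^sup>2" for n
  define G where "G n = (L2_norm \<Omega> (grad \<Omega> (uhat (n+1))))\<^sup>2" for n
  define H where "H n = (Hm1_norm \<Omega> (f (real (n+1) * \<Delta>t)))\<^sup>2" for n
  have one_step: "E (n+1) + 4 * \<gamma> * \<Delta>t * D n + 2 * \<nu> * \<Delta>t * G n \<le> 2 * \<Delta>t / \<nu> * H n + E n"
    if n: "n \<in> {1..N-1}" for n
  proof -
    let ?F = "f (real (n+1) * \<Delta>t)"
    have uhat: "uhat (n+1) \<in> Xh" "p (n+1) \<in> Qh"
      using step(1)[OF n] by (auto simp: mgd_step1_def)
    have S1: "L2_inner \<Omega> (\<lambda>x. (1 / (2 * \<Delta>t)) *\<^sub>R (3 *\<^sub>R uhat (n+1) x - 4 *\<^sub>R u n x + u (n-1) x)) v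
        + trilinear \<Omega> (\<lambda>x. 2 *\<^sub>R u n x - u (n-1) x) (uhat (n+1)) v
        + \<nu> * L2_inner \<Omega> (grad \<Omega> (uhat (n+1))) (grad \<Omega> v) - L2_inner \<Omega> (p (n+1)) (dvg \<Omega> v) = ?F v"
      if "v \<in> Xh" for v
      using step(1)[OF n] that unfolding mgd_step1_def by blast
    \<comment> \<open>The discrete divergence constraint, tested with the pressure itself.\<close>
    have "L2_inner \<Omega> (p (n+1)) (dvg \<Omega> (uhat (n+1))) = 0"
      using step(1)[OF n] uhat L2_inner_commute unfolding mgd_step1_def by metis
    \<comment> \<open>With \<open>uhat (n+1)\<close> in both of its last arguments, the two halves
      of the skew-symmetric form coincide and cancel.\<close>
    then have "?A (\<lambda>x. (1 / (2 * \<Delta>t)) *\<^sub>R (3 *\<^sub>R uhat (n+1) x - 4 *\<^sub>R u n x + u (n-1) x)) (uhat (n+1)) + \<nu> * G n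
        = ?F (uhat (n+1))"
      using S1[OF uhat(1)] unfolding G_def L2_norm_power2 trilinear_def by linarith
    then have "A.bdf2_energy (u (n+1)) (u n) + (2 * \<gamma> * \<Delta>t / 3 + \<beta>) * B.bdf2_energy (u (n+1)) (u n)
        + 4 * \<gamma> * \<Delta>t * ?B (u (n+1)) (u (n+1)) + 4 * \<nu> * \<Delta>t * G n
      \<le> 4 * \<Delta>t * ?F (uhat (n+1)) + A.bdf2_energy (u n) (u (n-1))
        + (2 * \<gamma> * \<Delta>t / 3 + \<beta>) * B.bdf2_energy (u n) (u (n-1))"
      using n uhat step(2)[OF n] \<Delta>t assms(10,11)
      by (intro bdf2_step_energy[OF A B]) (auto simp: mgd_step2_def intro: u_mem)
    \<comment> \<open>After multiplication by \<open>4 * \<Delta>t\<close> the gradient part is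
      \<open>2 * \<nu> * \<Delta>t * G n\<close>, exactly half of the viscous term on the left,
      which absorbs it.\<close>
    moreover have "?F (uhat (n+1)) \<le> H n / (2 * \<nu>) + \<nu> / 2 * G n"
      unfolding H_def G_def using n uhat assms(4) \<open>\<nu> > 0\<close> assms(16)[of "n+1"] by (intro Hm1_young) auto
    then have "4 * \<Delta>t * ?F (uhat (n+1)) \<le> 4 * \<Delta>t * (H n / (2 * \<nu>) + \<nu> / 2 * G n)"
      using \<Delta>t by simp
    then have "4 * \<Delta>t * ?F (uhat (n+1)) \<le> 2 * \<Delta>t / \<nu> * H n + 2 * \<nu> * \<Delta>t * G n"
      by (simp add: algebra_simps)
    ultimately show ?thesis
      unfolding E_def D_def L2_norm_power2 by simp
  qed
  \<comment> \<open>The one-step bounds telescope. The base case is \<open>E 1\<close> on both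
    sides, which also covers \<open>N = 1\<close> with its empty sums; \<open>m = N - 1\<close>
    reaches \<open>E N\<close>.\<close>
  have "E (Suc m) + 4 * \<gamma> * \<Delta>t * (\<Sum>n=1..m. D n) + 2 * \<nu> * \<Delta>t * (\<Sum>n=1..m. G n)
      \<le> 2 * \<Delta>t / \<nu> * (\<Sum>n=1..m. H n) + E 1" if "m \<le> N - 1" for m
    using that
  proof (induction m)
    case (Suc m)
    then show ?case
      using one_step[of "Suc m"] by (simp add: distrib_left)
  qed simp
  from this[of "N - 1"] show ?thesis
    using \<open>N \<ge> 1\<close>
    unfolding E_def D_def G_def H_def A.bdf2_energy_def B.bdf2_energy_def L2_norm_power2
    by (simp add: distrib_left)
qed

end
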